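(* Let $\lambda\in\mathbb{C}^*$ and let $\Psi_{\mathfrak{hc}}(\lambda)=\mathbb{C}[x,y]\oplus\mathbb{C}[s,t]$ be the associated module over the Heisenberg-Clifford superalgebra $\mathfrak{hc}$. (1) For $\alpha\in\mathbb{C}$, $\Psi_{\mathfrak{hc}}(\lambda)$ has the following submodule filtration: $$\cdots\subseteq(y-\alpha)^n\mathbb{C}[x,y]\oplus(t-\alpha)^n\mathbb{C}[s,t]\subseteq(y-\alpha)^{n-1}\mathbb{C}[x,y]\oplus(t-\alpha)^{n-1}\mathbb{C}[s,t]\subseteq\cdots\subseteq\mathbb{C}[x,y]\oplus\mathbb{C}[s,t].$$ (2) Let $b\in\mathbb{C}$ and $g(y),g'(y)\in\mathbb{C}[y]$ with $g(y)=(y-b)g'(y)$, and let $M_g^{\mathfrak{hc}}=g(y)\mathbb{C}[x,y]\oplus g(t)\mathbb{C}[s,t]\subseteq\Psi_{\mathfrak{hc}}(\lambda)$ (and likewise $M_{g'}^{\mathfrak{hc}}$). Then, as $\mathfrak{hc}$-modules, $M_{g'}^{\mathfrak{hc}}/M_g^{\mathfrak{hc}}\cong\Phi_{\mathfrak{hc}}(\lambda,b)$.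
   Context: All vector spaces are over $\mathbb{C}$; all modules over Lie superalgebras are $\mathbb{Z}_2$-graded; $\mathbb{C}^*$ is the set of nonzero complex numbers. The Heisenberg-Clifford superalgebra $\mathfrak{hc}$ is the Lie superalgebra with even basis elements $H_m$ ($m\in\mathbb{Z}$), $C_3$ and odd basis elements $Q_p$ ($p\in\mathbb{Z}+\frac12$), and brackets $[H_m,H_n]=m\delta_{m+n,0}C_3$, $[Q_p,Q_q]=\delta_{p+q,0}C_3$, $[H_m,Q_p]=0$, with $C_3$ central. $\Psi_{\mathfrak{hc}}(\lambda)$ is the $\mathfrak{hc}$-module with even part $\mathbb{C}[x,y]$, odd part $\mathbb{C}[s,t]$ and actions (for a two-variable polynomial $f$, $m\in\mathbb{Z}$, $p\in\mathbb{Z}+\frac12$): $H_mf(x,y)=\lambda^myf(x+m,y)$, $H_mf(s,t)=\lambda^mtf(s+m,t)$, $Q_pf(x,y)=0$, $Q_pf(s,t)=\lambda^{p+\frac12}yf(x+p,y)$, and $C_3$ acts as $0$. $\Phi_{\mathfrak{hc}}(\lambda,b)$ is the $\mathfrak{hc}$-module with even part $\mathbb{C}[x]$, odd part $\mathbb{C}[s]$ and nontrivial actions (for a one-variable polynomial $f$): $H_mf(x)=\lambda^mbf(x+m)$, $H_mf(s)=\lambda^mbf(s+m)$, $Q_pf(s)=\lambda^{p+\frac12}bf(x+p)$; the actions of $Q_p$ on $\mathbb{C}[x]$ and of $C_3$ are zero.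
   Formalization: In part (2) the polynomial g'(y) is assumed to be nonzero; for g' = 0 the quotient is zero while Φ(λ,b) is not, so the claim fails there. *)

theory Defs
  imports
    Complex_Main
    "HOL-Algebra.Module"
    "HOL-Algebra.AbelCoset"
    "HOL-Computational_Algebra.Polynomial"
    "HOL-Library.Poly_Mapping"
    "HOL-Library.Product_Plus"
    "HOL-Library.Z2"
begin

section \<open>Lie superalgebras and their modules\<close>

definition complex_ring :: "complex ring" where
  "complex_ring = \<lparr>carrier = UNIV, monoid.mult = (*), one = 1, zero = 0, add = (+)\<rparr>"

text \<open>
  Vector spaces are modules over \<^const>\<open>complex_ring\<close>.  The record \<^type>\<open>module\<close>
  extends \<^type>\<open>ring\<close>, so it has fields \<^const>\<open>monoid.mult\<close> and \<^const>\<open>one\<close>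
  which no module axiom mentions; they are left \<^term>\<open>undefined\<close> throughout.
  Parities are elements of \<^typ>\<open>bit\<close>, the integers modulo 2.
\<close>

record 'v superspace = "(complex, 'v) module" +
  homog :: "bit \<Rightarrow> 'v set"

locale superspace = Module.module complex_ring V for V :: "('v, 'm) superspace_scheme" (structure) +
  assumes homog_submodule: "submodule (homog V i) complex_ring V"
    and homog_sum: "carrier V = homog V 0 <+>\<^bsub>V\<^esub> homog V 1"
    and homog_inter: "homog V 0 \<inter> homog V 1 = {\<zero>\<^bsub>V\<^esub>}"

definition super_sign :: "bit \<Rightarrow> bit \<Rightarrow> complex" where
  "super_sign i j = (if i = 1 \<and> j = 1 then - 1 else 1)"

record 'l lie_superalgebra = "'l superspace" +
  bracket :: "'l \<Rightarrow> 'l \<Rightarrow> 'l"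

locale lie_superalgebra = superspace L
  for L :: "('l, 'm) lie_superalgebra_scheme" (structure) +
  assumes bracket_add_left: "\<lbrakk>u \<in> carrier L; v \<in> carrier L; w \<in> carrier L\<rbrakk> \<Longrightarrow>
      bracket L (u \<oplus>\<^bsub>L\<^esub> v) w = bracket L u w \<oplus>\<^bsub>L\<^esub> bracket L v w"
    and bracket_add_right: "\<lbrakk>u \<in> carrier L; v \<in> carrier L; w \<in> carrier L\<rbrakk> \<Longrightarrow>
      bracket L u (v \<oplus>\<^bsub>L\<^esub> w) = bracket L u v \<oplus>\<^bsub>L\<^esub> bracket L u w"
    and bracket_smult_left: "\<lbrakk>u \<in> carrier L; v \<in> carrier L\<rbrakk> \<Longrightarrow>
      bracket L (c \<odot>\<^bsub>L\<^esub> u) v = c \<odot>\<^bsub>L\<^esub> bracket L u v"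
    and bracket_smult_right: "\<lbrakk>u \<in> carrier L; v \<in> carrier L\<rbrakk> \<Longrightarrow>
      bracket L u (c \<odot>\<^bsub>L\<^esub> v) = c \<odot>\<^bsub>L\<^esub> bracket L u v"
    and bracket_homog: "\<lbrakk>u \<in> homog L i; v \<in> homog L j\<rbrakk> \<Longrightarrow> bracket L u v \<in> homog L (i + j)"
    and super_skew: "\<lbrakk>u \<in> homog L i; v \<in> homog L j\<rbrakk> \<Longrightarrow>
      bracket L u v = (- super_sign i j) \<odot>\<^bsub>L\<^esub> bracket L v u"
    and super_jacobi: "\<lbrakk>u \<in> homog L i; v \<in> homog L j; w \<in> homog L k\<rbrakk> \<Longrightarrow>
      bracket L u (bracket L v w) =
        bracket L (bracket L u v) w \<oplus>\<^bsub>L\<^esub> super_sign i j \<odot>\<^bsub>L\<^esub> bracket L v (bracket L u w)"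

record ('l, 'v) lie_supermodule = "'v superspace" +
  act :: "'l \<Rightarrow> 'v \<Rightarrow> 'v"

locale lie_supermodule = L?: lie_superalgebra L + V?: superspace V
  for L :: "('l, 'm) lie_superalgebra_scheme"
    and V :: "('l, 'v, 'n) lie_supermodule_scheme" (structure) +
  assumes act_add_left: "\<lbrakk>u \<in> carrier L; w \<in> carrier L; v \<in> carrier V\<rbrakk> \<Longrightarrow>
      act V (u \<oplus>\<^bsub>L\<^esub> w) v = act V u v \<oplus>\<^bsub>V\<^esub> act V w v"
    and act_add_right: "\<lbrakk>u \<in> carrier L; v \<in> carrier V; v' \<in> carrier V\<rbrakk> \<Longrightarrow>
      act V u (v \<oplus>\<^bsub>V\<^esub> v') = act V u v \<oplus>\<^bsub>V\<^esub> act V u v'"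
    and act_smult_left: "\<lbrakk>u \<in> carrier L; v \<in> carrier V\<rbrakk> \<Longrightarrow>
      act V (c \<odot>\<^bsub>L\<^esub> u) v = c \<odot>\<^bsub>V\<^esub> act V u v"
    and act_smult_right: "\<lbrakk>u \<in> carrier L; v \<in> carrier V\<rbrakk> \<Longrightarrow>
      act V u (c \<odot>\<^bsub>V\<^esub> v) = c \<odot>\<^bsub>V\<^esub> act V u v"
    and act_homog: "\<lbrakk>u \<in> homog L i; v \<in> homog V j\<rbrakk> \<Longrightarrow> act V u v \<in> homog V (i + j)"
    and act_bracket: "\<lbrakk>u \<in> homog L i; w \<in> homog L j; v \<in> carrier V\<rbrakk> \<Longrightarrow>
      act V (bracket L u w) v =
        act V u (act V w v) \<oplus>\<^bsub>V\<^esub> (- super_sign i j) \<odot>\<^bsub>V\<^esub> act V w (act V u v)"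

text \<open>Submodules are graded, i.e. spanned by their homogeneous elements.\<close>

definition lie_submodule ::
  "('l, 'm) lie_superalgebra_scheme \<Rightarrow> ('l, 'v, 'n) lie_supermodule_scheme \<Rightarrow> 'v set \<Rightarrow> bool" where
  "lie_submodule L V S \<longleftrightarrow>
     lie_supermodule L V \<and> submodule S complex_ring V \<and>
     S = (S \<inter> homog V 0) <+>\<^bsub>V\<^esub> (S \<inter> homog V 1) \<and>
     (\<forall>u\<in>carrier L. \<forall>v\<in>S. act V u v \<in> S)"

definition restrict_supermodule ::
  "('l, 'v) lie_supermodule \<Rightarrow> 'v set \<Rightarrow> ('l, 'v) lie_supermodule" where
  "restrict_supermodule V S = V\<lparr>carrier := S, homog := \<lambda>i. homog V i \<inter> S\<rparr>"

text \<open>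
  The elements of the quotient are the cosets of \<open>N\<close>.  For a submodule \<open>N\<close> all the cosets
  occurring in the unions below coincide, so \<open>c (v + N) = c v + N\<close> and \<open>u (v + N) = u v + N\<close>.
\<close>

definition quotient_supermodule ::
  "('l, 'v) lie_supermodule \<Rightarrow> 'v set \<Rightarrow> ('l, 'v set) lie_supermodule" where
  "quotient_supermodule V N =
     \<lparr>carrier = a_rcosets\<^bsub>V\<^esub> N, monoid.mult = undefined, one = undefined,
      zero = N, add = set_add V,
      module.smult = (\<lambda>c X. \<Union>v\<in>X. N +>\<^bsub>V\<^esub> (c \<odot>\<^bsub>V\<^esub> v)),
      homog = (\<lambda>i. (\<lambda>v. N +>\<^bsub>V\<^esub> v) ` homog V i),
      act = (\<lambda>u X. \<Union>v\<in>X. N +>\<^bsub>V\<^esub> act V u v)\<rparr>"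

text \<open>Isomorphisms are required to be even, i.e. to preserve the parity.\<close>

definition lie_supermodule_iso ::
  "('l, 'm) lie_superalgebra_scheme \<Rightarrow> ('l, 'v, 'n) lie_supermodule_scheme \<Rightarrow>
   ('l, 'w, 'k) lie_supermodule_scheme \<Rightarrow> ('v \<Rightarrow> 'w) \<Rightarrow> bool" where
  "lie_supermodule_iso L V W \<phi> \<longleftrightarrow>
     bij_betw \<phi> (carrier V) (carrier W) \<and>
     (\<forall>v\<in>carrier V. \<forall>w\<in>carrier V. \<phi> (v \<oplus>\<^bsub>V\<^esub> w) = \<phi> v \<oplus>\<^bsub>W\<^esub> \<phi> w) \<and>
     (\<forall>c. \<forall>v\<in>carrier V. \<phi> (c \<odot>\<^bsub>V\<^esub> v) = c \<odot>\<^bsub>W\<^esub> \<phi> v) \<and>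
     (\<forall>i. \<phi> ` homog V i \<subseteq> homog W i) \<and>
     (\<forall>u\<in>carrier L. \<forall>v\<in>carrier V. \<phi> (act V u v) = act W u (\<phi> v))"

definition lie_supermodule_isomorphic ::
  "('l, 'm) lie_superalgebra_scheme \<Rightarrow> ('l, 'v, 'n) lie_supermodule_scheme \<Rightarrow>
   ('l, 'w, 'k) lie_supermodule_scheme \<Rightarrow> bool" where
  "lie_supermodule_isomorphic L V W \<longleftrightarrow>
     lie_supermodule L V \<and> lie_supermodule L W \<and> (\<exists>\<phi>. lie_supermodule_iso L V W \<phi>)"


section \<open>The Heisenberg-Clifford superalgebra\<close>

text \<open>The odd generator with half-integer index \<open>p = k + 1/2\<close> is \<open>Q k\<close>, for an integer \<open>k\<close>.\<close>

datatype hc_basis = H int | Q int | C3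

primrec hc_parity :: "hc_basis \<Rightarrow> bit" where
  "hc_parity (H m) = 0"
| "hc_parity (Q k) = 1"
| "hc_parity C3 = 0"

type_synonym hc_elem = "hc_basis \<Rightarrow>\<^sub>0 complex"

text \<open>
  \<open>linear_ext sc F\<close> is the linear extension of \<open>F\<close> from the basis to \<^typ>\<open>hc_elem\<close>, for the
  scalar multiplication \<open>sc\<close> on the target.
\<close>

definition linear_ext ::
  "(complex \<Rightarrow> 'v \<Rightarrow> 'v) \<Rightarrow> (hc_basis \<Rightarrow> 'v) \<Rightarrow> hc_elem \<Rightarrow> 'v :: comm_monoid_add" where
  "linear_ext sc F u = (\<Sum>a\<in>Poly_Mapping.keys u. sc (Poly_Mapping.lookup u a) (F a))"

definition hc_smult :: "complex \<Rightarrow> hc_elem \<Rightarrow> hc_elem" where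
  "hc_smult c = Poly_Mapping.map ((*) c)"

text \<open>For \<open>p = k + 1/2\<close> and \<open>q = l + 1/2\<close>, the condition \<open>p + q = 0\<close> reads \<open>k + l + 1 = 0\<close>.\<close>

fun hc_bracket_basis :: "hc_basis \<Rightarrow> hc_basis \<Rightarrow> hc_elem" where
  "hc_bracket_basis (H m) (H n) =
     (if m + n = 0 then Poly_Mapping.single C3 (of_int m) else 0)"
| "hc_bracket_basis (Q k) (Q l) =
     (if k + l + 1 = 0 then Poly_Mapping.single C3 1 else 0)"
| "hc_bracket_basis _ _ = 0"

definition hc :: "hc_elem lie_superalgebra" where
  "hc = \<lparr>carrier = UNIV, monoid.mult = undefined, one = undefined,
      zero = 0, add = (+), module.smult = hc_smult,
      homog = (\<lambda>i. {u. \<forall>a\<in>Poly_Mapping.keys u. hc_parity a = i}),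
      bracket = (\<lambda>u v. linear_ext hc_smult
        (\<lambda>a. linear_ext hc_smult (\<lambda>b. hc_bracket_basis a b) v) u)\<rparr>"


section \<open>The modules\<close>

text \<open>
  The pair \<open>(f, h)\<close> stands for the sum of the even element \<open>f\<close> and the odd element \<open>h\<close>.
  Bivariate polynomials \<open>f(x,y)\<close>, or \<open>h(s,t)\<close>, have type \<^typ>\<open>complex poly poly\<close>: the outer
  variable is \<open>x\<close> (or \<open>s\<close>), and the coefficients are polynomials in \<open>y\<close> (or \<open>t\<close>).  Hence
  multiplication by \<open>g(y)\<close> is \<^term>\<open>Polynomial.smult g\<close>, and renaming \<open>(s,t)\<close> to \<open>(x,y)\<close> is
  the identity.
\<close>

type_synonym psi_elem = "complex poly poly \<times> complex poly poly"
type_synonym phi_elem = "complex poly \<times> complex poly"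

text \<open>The substitution \<open>f(x + a, y)\<close>, respectively \<open>f(x + a)\<close>.\<close>

definition shift2 :: "complex \<Rightarrow> complex poly poly \<Rightarrow> complex poly poly" where
  "shift2 a f = pcompose f [:[:a:], 1:]"

definition shift1 :: "complex \<Rightarrow> complex poly \<Rightarrow> complex poly" where
  "shift1 a f = pcompose f [:a, 1:]"

text \<open>
  For \<open>p = k + 1/2\<close> the power of \<open>\<lambda>\<close> in the action of the odd generators is
  \<open>p + 1/2 = k + 1\<close>.
\<close>

fun psi_act_basis :: "complex \<Rightarrow> hc_basis \<Rightarrow> psi_elem \<Rightarrow> psi_elem" where
  "psi_act_basis lam (H m) (f, h) =
     (Polynomial.smult [:0, lam powi m:] (shift2 (of_int m) f),
      Polynomial.smult [:0, lam powi m:] (shift2 (of_int m) h))"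
| "psi_act_basis lam (Q k) (f, h) =
     (Polynomial.smult [:0, lam powi (k + 1):] (shift2 (of_int k + 1 / 2) h), 0)"
| "psi_act_basis lam C3 (f, h) = (0, 0)"

definition psi_smult :: "complex \<Rightarrow> psi_elem \<Rightarrow> psi_elem" where
  "psi_smult c = (\<lambda>(f, h). (Polynomial.smult [:c:] f, Polynomial.smult [:c:] h))"

definition Psi_hc :: "complex \<Rightarrow> (hc_elem, psi_elem) lie_supermodule" where
  "Psi_hc lam = \<lparr>carrier = UNIV, monoid.mult = undefined, one = undefined,
      zero = 0, add = (+), module.smult = psi_smult,
      homog = (\<lambda>i. if i = 0 then UNIV \<times> {0} else {0} \<times> UNIV),
      act = (\<lambda>u v. linear_ext psi_smult (\<lambda>a. psi_act_basis lam a v) u)\<rparr>"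

fun phi_act_basis :: "complex \<Rightarrow> complex \<Rightarrow> hc_basis \<Rightarrow> phi_elem \<Rightarrow> phi_elem" where
  "phi_act_basis lam b (H m) (f, h) =
     (Polynomial.smult (lam powi m * b) (shift1 (of_int m) f),
      Polynomial.smult (lam powi m * b) (shift1 (of_int m) h))"
| "phi_act_basis lam b (Q k) (f, h) =
     (Polynomial.smult (lam powi (k + 1) * b) (shift1 (of_int k + 1 / 2) h), 0)"
| "phi_act_basis lam b C3 (f, h) = (0, 0)"

definition phi_smult :: "complex \<Rightarrow> phi_elem \<Rightarrow> phi_elem" where
  "phi_smult c = (\<lambda>(f, h). (Polynomial.smult c f, Polynomial.smult c h))"

definition Phi_hc :: "complex \<Rightarrow> complex \<Rightarrow> (hc_elem, phi_elem) lie_supermodule" where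
  "Phi_hc lam b = \<lparr>carrier = UNIV, monoid.mult = undefined, one = undefined,
      zero = 0, add = (+), module.smult = phi_smult,
      homog = (\<lambda>i. if i = 0 then UNIV \<times> {0} else {0} \<times> UNIV),
      act = (\<lambda>u v. linear_ext phi_smult (\<lambda>a. phi_act_basis lam b a v) u)\<rparr>"

text \<open>The subspace \<open>g(y) C[x,y] \<oplus> g(t) C[s,t]\<close>.\<close>

definition M_hc :: "complex poly \<Rightarrow> psi_elem set" where
  "M_hc g = range (Polynomial.smult g) \<times> range (Polynomial.smult g)"

end

theory Submission
  imports Defs
begin

text \<open>
  Write \<open>G\<close> for multiplication by \<open>g(y)\<close> on the even part and by \<open>g(t)\<close> on the odd part of \<open>\<Psi>(\<lambda>)\<close>.
  The Heisenberg-Clifford superalgebra acts on \<open>\<Psi>(\<lambda>)\<close> by shifting \<open>x\<close> and multiplying by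
  multiples of \<open>y\<close>, and both operations commute with \<open>G\<close>.  So \<open>G\<close> is an endomorphism of
  \<open>\<Psi>(\<lambda>)\<close>, and \<open>M\<^sub>g\<close>, which is its image, is a submodule (\<open>lie_submodule_M_hc\<close>).
  The inclusions of the filtration are then divisibilities: \<open>M\<^bsub>pg\<^esub> \<subseteq> M\<^sub>g\<close>.

  Setting \<open>y = b\<close> turns multiplication by \<open>y\<close> into multiplication by \<open>b\<close> and leaves the shifts of
  \<open>x\<close> alone; it is therefore a surjective homomorphism \<open>\<Psi>(\<lambda>) \<rightarrow> \<Phi>(\<lambda>,b)\<close>, and its kernel is
  \<open>M\<^bsub>y-b\<^esub>\<close>.  For \<open>g' \<noteq> 0\<close>, multiplication by \<open>g'\<close> is an isomorphism of \<open>\<Psi>(\<lambda>)\<close>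
  onto \<open>M\<^bsub>g'\<^esub>\<close> which carries \<open>M\<^bsub>y-b\<^esub>\<close> to \<open>M\<^sub>g\<close>, where \<open>g = (y-b)g'\<close>.
  Dividing by \<open>g'\<close> and then evaluating at \<open>b\<close> is thus a surjection \<open>M\<^bsub>g'\<^esub> \<rightarrow> \<Phi>(\<lambda>,b)\<close> with
  kernel \<open>M\<^sub>g\<close>, and the first isomorphism theorem (\<open>quotient_supermodule_isomorphic\<close>) gives the
  second claim (\<open>quotient_M_hc_isomorphic\<close>).

  That the objects involved satisfy the axioms has simple reasons as well.  All
  brackets of \<open>hc\<close> lie in the line spanned by \<open>C\<^sub>3\<close>, which is central, so every double bracket
  vanishes and the Jacobi identity is trivial.  On \<open>\<Psi>\<close> and \<open>\<Phi>\<close> the element \<open>C\<^sub>3\<close> acts by zero, so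
  the module axiom only asks that the generators supercommute; they do, because the
  underlying operators on polynomials commute with each other and a product of two odd generators acts
  by zero.
\<close>

section \<open>Superspaces\<close>

lemma complex_ring_simps [simp]:
  "carrier complex_ring = UNIV" "x \<otimes>\<^bsub>complex_ring\<^esub> y = x * y" "\<one>\<^bsub>complex_ring\<^esub> = 1"
  "\<zero>\<^bsub>complex_ring\<^esub> = 0" "x \<oplus>\<^bsub>complex_ring\<^esub> y = x + y"
  by (simp_all add: complex_ring_def)

lemma cring_complex_ring: "cring complex_ring"
proof (rule cringI)
  show "abelian_group complex_ring"
    by (rule abelian_groupI) (auto simp: algebra_simps intro: exI[of _ "- x" for x])
  show "comm_monoid complex_ring"
    by (rule comm_monoidI) (auto simp: algebra_simps)
qed (auto simp: algebra_simps)

text \<open>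
  Negatives do not occur among the hypotheses: \<open>(-1) \<odot> x\<close> is a negative of \<open>x\<close>, by
  distributivity and the law \<open>0 \<odot> x = 0\<close>.
\<close>

lemma module_complexI:
  fixes V (structure)
  assumes add_closed: "\<And>x y. \<lbrakk>x \<in> carrier V; y \<in> carrier V\<rbrakk> \<Longrightarrow> x \<oplus> y \<in> carrier V"
    and zero_closed: "\<zero> \<in> carrier V"
    and add_assoc: "\<And>x y z. \<lbrakk>x \<in> carrier V; y \<in> carrier V; z \<in> carrier V\<rbrakk> \<Longrightarrow>
      (x \<oplus> y) \<oplus> z = x \<oplus> (y \<oplus> z)"
    and add_comm: "\<And>x y. \<lbrakk>x \<in> carrier V; y \<in> carrier V\<rbrakk> \<Longrightarrow> x \<oplus> y = y \<oplus> x"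
    and add_zero: "\<And>x. x \<in> carrier V \<Longrightarrow> \<zero> \<oplus> x = x"
    and smult_closed: "\<And>c x. x \<in> carrier V \<Longrightarrow> c \<odot> x \<in> carrier V"
    and smult_l_distr: "\<And>c d x. x \<in> carrier V \<Longrightarrow> (c + d) \<odot> x = c \<odot> x \<oplus> d \<odot> x"
    and smult_r_distr: "\<And>c x y. \<lbrakk>x \<in> carrier V; y \<in> carrier V\<rbrakk> \<Longrightarrow>
      c \<odot> (x \<oplus> y) = c \<odot> x \<oplus> c \<odot> y"
    and smult_assoc: "\<And>c d x. x \<in> carrier V \<Longrightarrow> (c * d) \<odot> x = c \<odot> (d \<odot> x)"
    and smult_one: "\<And>x. x \<in> carrier V \<Longrightarrow> 1 \<odot> x = x"
    and smult_zero: "\<And>x. x \<in> carrier V \<Longrightarrow> (0::complex) \<odot> x = \<zero>"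
  shows "Module.module complex_ring V"
proof (rule moduleI)
  show "abelian_group V"
  proof (rule abelian_groupI)
    fix x assume x: "x \<in> carrier V"
    have "(- 1) \<odot> x \<oplus> x = (- 1 + 1) \<odot> x"
      using smult_l_distr[OF x, of "- 1" 1] smult_one[OF x] by simp
    then show "\<exists>y\<in>carrier V. y \<oplus> x = \<zero>"
      using smult_zero[OF x] smult_closed[OF x] by (intro bexI[of _ "(- 1) \<odot> x"]) simp_all
  qed (use assms in auto)
qed (use assms cring_complex_ring in auto)

lemma uminus_complex_ring: "\<ominus>\<^bsub>complex_ring\<^esub> c = - c"
proof -
  interpret cring complex_ring by (rule cring_complex_ring)
  show ?thesis by (rule minus_equality) auto
qed

lemma submodule_complex_iff:
  assumes "Module.module complex_ring V"
  shows "submodule S complex_ring V \<longleftrightarrow>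
    S \<subseteq> carrier V \<and> \<zero>\<^bsub>V\<^esub> \<in> S \<and> (\<forall>x\<in>S. \<forall>y\<in>S. x \<oplus>\<^bsub>V\<^esub> y \<in> S) \<and> (\<forall>c. \<forall>x\<in>S. c \<odot>\<^bsub>V\<^esub> x \<in> S)"
    (is "_ \<longleftrightarrow> ?closed")
proof
  interpret Module.module complex_ring V by fact
  show ?closed if "submodule S complex_ring V"
    using submoduleE(1,2,4,5)[OF that] subgroup.one_closed[of S "add_monoid V"] that
    by (auto simp: submodule_def)
  assume ?closed
  moreover have "\<ominus>\<^bsub>V\<^esub> x = (- 1) \<odot>\<^bsub>V\<^esub> x" if "x \<in> carrier V" for x
    using smult_l_minus[of 1 x] smult_one[OF that] that by (simp add: uminus_complex_ring)
  ultimately show "submodule S complex_ring V"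
    by (intro submoduleI) auto
qed

lemma (in superspace) homog_subset: "homog V i \<subseteq> carrier V"
  using homog_submodule[of i] by (simp add: submodule_complex_iff module_axioms)

lemma (in superspace) homog_decompose:
  assumes "v \<in> carrier V"
  obtains x y where "x \<in> homog V 0" "y \<in> homog V 1" "v = x \<oplus>\<^bsub>V\<^esub> y"
  using assms by (auto simp: homog_sum set_add_def')

text \<open>
  The module axioms place \<open>u v\<close> in the carrier only for homogeneous \<open>u\<close> and \<open>v\<close>; the general case
  follows by decomposing both.
\<close>

lemma (in lie_supermodule) act_closed:
  assumes "u \<in> carrier L" "v \<in> carrier V"
  shows "act V u v \<in> carrier V"
proof -
  obtain u0 u1 where u: "u0 \<in> homog L 0" "u1 \<in> homog L 1" "u = u0 \<oplus>\<^bsub>L\<^esub> u1"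
    using assms(1) by (rule L.homog_decompose)
  obtain v0 v1 where v: "v0 \<in> homog V 0" "v1 \<in> homog V 1" "v = v0 \<oplus>\<^bsub>V\<^esub> v1"
    using assms(2) by (rule V.homog_decompose)
  have homog_closed: "act V u' v' \<in> carrier V" if "u' \<in> homog L i" "v' \<in> homog V j" for u' v' i j
    using act_homog[OF that] V.homog_subset by blast
  have carr: "u0 \<in> carrier L" "u1 \<in> carrier L" "v0 \<in> carrier V" "v1 \<in> carrier V"
    using u v L.homog_subset V.homog_subset by blast+
  have "act V u' v \<in> carrier V" if "u' \<in> homog L i" for u' i
    using v carr that homog_closed[OF that] L.homog_subset
    by (simp add: act_add_right subset_iff)
  then show ?thesis
    using u carr assms(2) by (simp add: act_add_left)
qed

section \<open>Transport of structure\<close>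

lemma superspace_image:
  fixes W :: "('w, 'k) superspace_scheme" and Q :: "('q, 'm) superspace_scheme"
  assumes W: "superspace W"
    and inj: "inj_on \<psi> (carrier W)"
    and carr: "carrier Q = \<psi> ` carrier W"
    and zero: "\<zero>\<^bsub>Q\<^esub> = \<psi> \<zero>\<^bsub>W\<^esub>"
    and add: "\<And>x y. \<lbrakk>x \<in> carrier W; y \<in> carrier W\<rbrakk> \<Longrightarrow> \<psi> x \<oplus>\<^bsub>Q\<^esub> \<psi> y = \<psi> (x \<oplus>\<^bsub>W\<^esub> y)"
    and smult: "\<And>c x. x \<in> carrier W \<Longrightarrow> c \<odot>\<^bsub>Q\<^esub> \<psi> x = \<psi> (c \<odot>\<^bsub>W\<^esub> x)"
    and homog: "\<And>i. homog Q i = \<psi> ` homog W i"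
  shows "superspace Q"
proof -
  interpret superspace W by fact
  have mod: "Module.module complex_ring Q"
    by (rule module_complexI)
      (auto simp: carr zero add smult a_ac smult_l_distr[simplified] smult_r_distr smult_assoc1[simplified]
        smult_one[simplified] smult_l_null[simplified])
  note sub = homog_subset
  show ?thesis
  proof (rule superspace.intro[OF mod], rule superspace_axioms.intro)
    show "submodule (homog Q i) complex_ring Q" for i
      using homog_submodule[of i]
      by (simp add: submodule_complex_iff mod module_axioms homog carr zero)
        (auto simp: add smult subset_iff image_iff)
    show "carrier Q = homog Q 0 <+>\<^bsub>Q\<^esub> homog Q 1"
    proof -
      have "carrier Q = (\<Union>h\<in>homog W 0. \<Union>k\<in>homog W 1. {\<psi> (h \<oplus>\<^bsub>W\<^esub> k)})"
        by (simp add: carr homog_sum set_add_def' image_UN)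
      also have "\<dots> = (\<Union>h\<in>homog W 0. \<Union>k\<in>homog W 1. {\<psi> h \<oplus>\<^bsub>Q\<^esub> \<psi> k})"
        using sub by (intro SUP_cong refl) (auto simp: add subset_iff)
      finally show ?thesis
        by (simp add: homog set_add_def')
    qed
    show "homog Q 0 \<inter> homog Q 1 = {\<zero>\<^bsub>Q\<^esub>}"
      using homog_inter inj_on_image_Int[OF inj sub sub, of 0 1] by (simp add: homog zero)
  qed
qed

text \<open>
  A structure \<open>Q\<close> whose operations are those of a supermodule \<open>W\<close>, carried over along a bijection \<open>\<psi>\<close>,
  inherits every axiom from \<open>W\<close>.  For quotients this replaces the verification of the axioms on cosets.
\<close>

lemma lie_supermodule_isomorphic_image:
  fixes W :: "('l, 'w, 'k) lie_supermodule_scheme" and Q :: "('l, 'q, 'm) lie_supermodule_scheme"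
  assumes W: "lie_supermodule L W"
    and inj: "inj_on \<psi> (carrier W)"
    and carr: "carrier Q = \<psi> ` carrier W"
    and zero: "\<zero>\<^bsub>Q\<^esub> = \<psi> \<zero>\<^bsub>W\<^esub>"
    and add: "\<And>x y. \<lbrakk>x \<in> carrier W; y \<in> carrier W\<rbrakk> \<Longrightarrow> \<psi> x \<oplus>\<^bsub>Q\<^esub> \<psi> y = \<psi> (x \<oplus>\<^bsub>W\<^esub> y)"
    and smult: "\<And>c x. x \<in> carrier W \<Longrightarrow> c \<odot>\<^bsub>Q\<^esub> \<psi> x = \<psi> (c \<odot>\<^bsub>W\<^esub> x)"
    and homog: "\<And>i. homog Q i = \<psi> ` homog W i"
    and act: "\<And>u x. \<lbrakk>u \<in> carrier L; x \<in> carrier W\<rbrakk> \<Longrightarrow> act Q u (\<psi> x) = \<psi> (act W u x)"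
  shows "lie_supermodule_isomorphic L Q W"
proof -
  interpret lie_supermodule L W by fact
  note subL = L.homog_subset and subW = V.homog_subset
  have "superspace Q"
    by (rule superspace_image[OF V.superspace_axioms inj carr zero add smult homog])
  have Q: "lie_supermodule L Q"
  proof (rule lie_supermodule.intro[OF L.lie_superalgebra_axioms \<open>superspace Q\<close>], unfold_locales)
    show "act Q u v \<in> homog Q (i + j)" if "u \<in> homog L i" "v \<in> homog Q j" for u v i j
      using that act subL subW act_homog[of u i _ j] by (auto simp: homog subset_iff image_iff)
    show "act Q (bracket L u w) v =
        act Q u (act Q w v) \<oplus>\<^bsub>Q\<^esub> (- super_sign i j) \<odot>\<^bsub>Q\<^esub> act Q w (act Q u v)"
      if "u \<in> homog L i" "w \<in> homog L j" "v \<in> carrier Q" for u w v i j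
    proof -
      from that have "u \<in> carrier L" "w \<in> carrier L" "bracket L u w \<in> carrier L"
        using subL L.bracket_homog[OF that(1,2)] by auto
      then show ?thesis
        using that act_bracket[OF that(1,2)]
        by (auto simp: carr act act_closed add smult)
    qed
  qed (auto simp: carr act act_closed add smult act_add_left act_add_right act_smult_left
      act_smult_right)
  have "lie_supermodule_iso L Q W (inv_into (carrier W) \<psi>)"
    unfolding lie_supermodule_iso_def
  proof (intro conjI ballI allI)
    show "bij_betw (inv_into (carrier W) \<psi>) (carrier Q) (carrier W)"
      unfolding carr by (rule bij_betw_inv_into[OF inj_on_imp_bij_betw[OF inj]])
    show "inv_into (carrier W) \<psi> ` homog Q i \<subseteq> homog W i" for i
      using inv_into_image_cancel[OF inj subW] by (simp add: homog)
  qed (auto simp: carr add smult act act_closed inj)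
  then show ?thesis
    using W Q by (auto simp: lie_supermodule_isomorphic_def)
qed

section \<open>The first isomorphism theorem\<close>

text \<open>
  The cosets of the kernel \<open>N\<close> are the fibers of \<open>\<phi>\<close>.  Hence \<open>w \<mapsto> \<phi>\<inverse>(w)\<close> is a bijection
  from \<open>W\<close> to \<open>V/N\<close> which carries over the structure; in particular \<open>V/N\<close> is a supermodule.
  The homogeneous parts of \<open>V/N\<close> are images of those of \<open>V\<close>, which is why \<open>\<phi>\<close> is required to be
  onto in each parity.
\<close>

lemma quotient_supermodule_isomorphic:
  fixes V :: "('l, 'v) lie_supermodule" and W :: "('l, 'w, 'k) lie_supermodule_scheme"
  assumes V: "lie_supermodule L V" and W: "lie_supermodule L W"
    and surj: "\<phi> ` carrier V = carrier W"
    and add: "\<And>v w. \<lbrakk>v \<in> carrier V; w \<in> carrier V\<rbrakk> \<Longrightarrow> \<phi> (v \<oplus>\<^bsub>V\<^esub> w) = \<phi> v \<oplus>\<^bsub>W\<^esub> \<phi> w"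
    and smult: "\<And>c v. v \<in> carrier V \<Longrightarrow> \<phi> (c \<odot>\<^bsub>V\<^esub> v) = c \<odot>\<^bsub>W\<^esub> \<phi> v"
    and homog: "\<And>i. \<phi> ` homog V i = homog W i"
    and act: "\<And>u v. \<lbrakk>u \<in> carrier L; v \<in> carrier V\<rbrakk> \<Longrightarrow> \<phi> (act V u v) = act W u (\<phi> v)"
    and kernel: "N = {v \<in> carrier V. \<phi> v = \<zero>\<^bsub>W\<^esub>}"
  shows "lie_supermodule_isomorphic L (quotient_supermodule V N) W"
proof -
  interpret V: superspace V using V by (rule lie_supermodule.axioms)
  interpret W: lie_supermodule L W by fact
  note act_V = lie_supermodule.act_closed[OF V]
  define fiber where "fiber w = {v \<in> carrier V. \<phi> v = w}" for w
  have \<phi>_closed: "\<phi> v \<in> carrier W" if "v \<in> carrier V" for v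
    using surj that by auto
  have coset: "N +>\<^bsub>V\<^esub> v = fiber (\<phi> v)" if v: "v \<in> carrier V" for v
  proof
    show "N +>\<^bsub>V\<^esub> v \<subseteq> fiber (\<phi> v)"
      using v \<phi>_closed by (auto simp: a_r_coset_def' kernel fiber_def add)
    show "fiber (\<phi> v) \<subseteq> N +>\<^bsub>V\<^esub> v"
    proof
      \<comment> \<open>An element of the fiber of \<open>v\<close> differs from \<open>v\<close> by the element \<open>w - v\<close> of the kernel.\<close>
      fix w assume "w \<in> fiber (\<phi> v)"
      then have w: "w \<in> carrier V" "\<phi> w = \<phi> v" by (auto simp: fiber_def)
      have neg: "(- 1) \<odot>\<^bsub>V\<^esub> v = \<ominus>\<^bsub>V\<^esub> v"
        using V.smult_l_minus[of 1 v] V.smult_one[OF v] v by (simp add: uminus_complex_ring)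
      have "\<phi> (w \<oplus>\<^bsub>V\<^esub> (- 1) \<odot>\<^bsub>V\<^esub> v) = 1 \<odot>\<^bsub>W\<^esub> \<phi> v \<oplus>\<^bsub>W\<^esub> (- 1) \<odot>\<^bsub>W\<^esub> \<phi> v"
        using w v \<phi>_closed W.V.smult_one by (simp add: add smult)
      also have "\<dots> = \<zero>\<^bsub>W\<^esub>"
        using W.V.smult_l_distr[of 1 "- 1" "\<phi> v"] \<phi>_closed[OF v] W.V.smult_l_null[of "\<phi> v"] by simp
      finally have "w \<oplus>\<^bsub>V\<^esub> (- 1) \<odot>\<^bsub>V\<^esub> v \<in> N"
        using w v by (simp add: kernel)
      moreover have "w = (w \<oplus>\<^bsub>V\<^esub> (- 1) \<odot>\<^bsub>V\<^esub> v) \<oplus>\<^bsub>V\<^esub> v"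
        using w v by (simp add: neg V.a_assoc V.l_neg)
      ultimately show "w \<in> N +>\<^bsub>V\<^esub> v"
        by (auto simp: a_r_coset_def')
    qed
  qed
  have nonempty: "\<exists>v\<in>carrier V. \<phi> v = w" if "w \<in> carrier W" for w
    using that by (auto simp flip: surj)
  show ?thesis
  proof (rule lie_supermodule_isomorphic_image[OF W, where \<psi> = fiber])
    show "inj_on fiber (carrier W)"
      using nonempty by (fastforce simp: inj_on_def fiber_def)
    show "carrier (quotient_supermodule V N) = fiber ` carrier W"
      by (auto simp: quotient_supermodule_def A_RCOSETS_def' coset simp flip: surj)
    show "\<zero>\<^bsub>quotient_supermodule V N\<^esub> = fiber \<zero>\<^bsub>W\<^esub>"
      by (simp add: quotient_supermodule_def kernel fiber_def)
    show "homog (quotient_supermodule V N) i = fiber ` homog W i" for i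
      using V.homog_subset by (auto simp: quotient_supermodule_def image_image coset subset_iff simp flip: homog)
    show "fiber x \<oplus>\<^bsub>quotient_supermodule V N\<^esub> fiber y = fiber (x \<oplus>\<^bsub>W\<^esub> y)"
      if "x \<in> carrier W" "y \<in> carrier W" for x y
    proof -
      obtain v w where v: "v \<in> carrier V" "\<phi> v = x" and w: "w \<in> carrier V" "\<phi> w = y"
        using nonempty \<open>x \<in> carrier W\<close> \<open>y \<in> carrier W\<close> by metis
      have "fiber (x \<oplus>\<^bsub>W\<^esub> y) \<subseteq> fiber x <+>\<^bsub>V\<^esub> fiber y"
      proof
        fix z assume "z \<in> fiber (x \<oplus>\<^bsub>W\<^esub> y)"
        then have "z \<in> N +>\<^bsub>V\<^esub> (v \<oplus>\<^bsub>V\<^esub> w)"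
          using v w by (simp add: coset add)
        then obtain n where n: "n \<in> N" "z = (n \<oplus>\<^bsub>V\<^esub> v) \<oplus>\<^bsub>V\<^esub> w"
          using v w by (auto simp: a_r_coset_def' kernel V.a_assoc)
        moreover have "n \<oplus>\<^bsub>V\<^esub> v \<in> fiber x"
          using n v that by (simp add: kernel fiber_def add)
        moreover have "w \<in> fiber y" using w by (simp add: fiber_def)
        ultimately show "z \<in> fiber x <+>\<^bsub>V\<^esub> fiber y"
          by (auto simp: set_add_def')
      qed
      moreover have "fiber x <+>\<^bsub>V\<^esub> fiber y \<subseteq> fiber (x \<oplus>\<^bsub>W\<^esub> y)"
        by (auto simp: set_add_def' fiber_def add)
      ultimately show ?thesis by (simp add: quotient_supermodule_def)
    qed
    show "c \<odot>\<^bsub>quotient_supermodule V N\<^esub> fiber x = fiber (c \<odot>\<^bsub>W\<^esub> x)" if "x \<in> carrier W" for c x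
    proof -
      have "N +>\<^bsub>V\<^esub> (c \<odot>\<^bsub>V\<^esub> v) = fiber (c \<odot>\<^bsub>W\<^esub> x)" if "v \<in> fiber x" for v
        using that by (auto simp: fiber_def coset smult)
      moreover have "fiber x \<noteq> {}" using nonempty[OF that] by (auto simp: fiber_def)
      ultimately show ?thesis by (auto simp: quotient_supermodule_def)
    qed
    show "act (quotient_supermodule V N) u (fiber x) = fiber (act W u x)"
      if "u \<in> carrier L" "x \<in> carrier W" for u x
    proof -
      have "N +>\<^bsub>V\<^esub> act V u v = fiber (act W u x)" if "v \<in> fiber x" for v
        using that \<open>u \<in> carrier L\<close> by (auto simp: fiber_def coset act act_V)
      moreover have "fiber x \<noteq> {}" using nonempty[OF that(2)] by (auto simp: fiber_def)
      ultimately show ?thesis by (auto simp: quotient_supermodule_def)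
    qed
  qed
qed

section \<open>Restriction to a submodule\<close>

lemma lie_submodule_imp_supermodule_restrict:
  assumes S: "lie_submodule L V S"
  shows "lie_supermodule L (restrict_supermodule V S)"
proof -
  interpret lie_supermodule L V using S by (simp add: lie_submodule_def)
  let ?R = "restrict_supermodule V S"
  have R: "carrier ?R = S" "add ?R = add V" "zero ?R = zero V"
    "module.smult ?R = module.smult V" "homog ?R i = homog V i \<inter> S" "act ?R = act V" for i
    by (simp_all add: restrict_supermodule_def)
  have S_closed: "x \<in> carrier V" "y \<in> S \<Longrightarrow> x \<oplus>\<^bsub>V\<^esub> y \<in> S" "c \<odot>\<^bsub>V\<^esub> x \<in> S"
      "u \<in> carrier L \<Longrightarrow> act V u x \<in> S"
    if "x \<in> S" for x y c u
    using S that by (auto simp: lie_submodule_def submodule_complex_iff[OF V.module_axioms])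
  have zero: "\<zero>\<^bsub>V\<^esub> \<in> S"
    using S by (auto simp: lie_submodule_def submodule_complex_iff[OF V.module_axioms])
  have V_homog: "homog V i \<subseteq> carrier V" "\<zero>\<^bsub>V\<^esub> \<in> homog V i"
      "x \<in> homog V i \<Longrightarrow> y \<in> homog V i \<Longrightarrow> x \<oplus>\<^bsub>V\<^esub> y \<in> homog V i"
      "x \<in> homog V i \<Longrightarrow> c \<odot>\<^bsub>V\<^esub> x \<in> homog V i" for x y c i
    using V.homog_submodule[of i] by (auto simp: submodule_complex_iff[OF V.module_axioms])
  have mod: "Module.module complex_ring ?R"
    by (rule module_complexI)
      (auto simp: R zero S_closed V.M.a_assoc V.M.a_comm V.M.a_lcomm V.smult_l_distr[simplified] V.smult_r_distr
        V.smult_assoc1[simplified] V.smult_one[simplified] V.smult_l_null[simplified])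
  have "superspace ?R"
  proof (rule superspace.intro[OF mod], rule superspace_axioms.intro)
    show "submodule (homog ?R i) complex_ring ?R" for i
      using V_homog by (auto simp: submodule_complex_iff[OF mod] R zero S_closed)
    show "carrier ?R = homog ?R 0 <+>\<^bsub>?R\<^esub> homog ?R 1"
      using S by (simp add: R lie_submodule_def set_add_def' Int_commute)
    show "homog ?R 0 \<inter> homog ?R 1 = {\<zero>\<^bsub>?R\<^esub>}"
      using V.homog_inter zero by (auto simp: R)
  qed
  have L_homog: "u \<in> carrier L" if "u \<in> homog L i" for u i
    using L.homog_subset that by blast
  show ?thesis
  proof (rule lie_supermodule.intro[OF L.lie_superalgebra_axioms \<open>superspace ?R\<close>],
      rule lie_supermodule_axioms.intro)
    show "act ?R u v \<in> homog ?R (i + j)" if "u \<in> homog L i" "v \<in> homog ?R j" for u v i j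
      using that L_homog act_homog[of u i v j] by (simp add: R S_closed)
  qed (use S_closed(1) in \<open>auto simp: R act_add_left act_add_right act_smult_left act_smult_right act_bracket\<close>)
qed

lemma lie_submodule_restrict:
  assumes S: "lie_submodule L V S" and N: "lie_submodule L V N" and sub: "N \<subseteq> S"
  shows "lie_submodule L (restrict_supermodule V S) N"
proof -
  interpret V: lie_supermodule L V using S by (simp add: lie_submodule_def)
  interpret R: lie_supermodule L "restrict_supermodule V S"
    by (rule lie_submodule_imp_supermodule_restrict[OF S])
  have "N \<inter> (homog V i \<inter> S) = N \<inter> homog V i" for i
    using sub by blast
  then show ?thesis
    using N sub R.lie_supermodule_axioms
    unfolding lie_submodule_def submodule_complex_iff[OF V.V.module_axioms]
      submodule_complex_iff[OF R.V.module_axioms]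
    by (simp add: restrict_supermodule_def set_add_def')
qed

section \<open>Linear extension\<close>

text \<open>
  The action of \<open>hc\<close> on a module, and also its bracket, are linear extensions from the basis;
  their laws are instances of the following rules, for the scalar multiplication \<open>sc\<close> of the
  respective space.
\<close>

locale complex_vector_space = vector_space sc for sc :: "complex \<Rightarrow> 'v::ab_group_add \<Rightarrow> 'v"

lemma lookup_hc_smult [simp]:
  "Poly_Mapping.lookup (hc_smult c u) a = c * Poly_Mapping.lookup u a"
  by (simp add: hc_smult_def Poly_Mapping.map.rep_eq when_def)

lemma keys_hc_smult: "Poly_Mapping.keys (hc_smult c u) \<subseteq> Poly_Mapping.keys u"
  by (auto simp: in_keys_iff)

interpretation hc_space: complex_vector_space hc_smult
  by unfold_locales (simp_all add: poly_mapping_eq_iff fun_eq_iff lookup_add algebra_simps)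

context complex_vector_space
begin

lemma linear_ext_superset:
  assumes "finite A" "Poly_Mapping.keys u \<subseteq> A"
  shows "linear_ext sc F u = (\<Sum>a\<in>A. sc (Poly_Mapping.lookup u a) (F a))"
  unfolding linear_ext_def
  by (rule sum.mono_neutral_left) (use assms in \<open>auto simp: in_keys_iff\<close>)

lemma linear_ext_add: "linear_ext sc F (u + w) = linear_ext sc F u + linear_ext sc F w"
proof -
  let ?A = "Poly_Mapping.keys u \<union> Poly_Mapping.keys w"
  have "Poly_Mapping.keys (u + w) \<subseteq> ?A" by (rule keys_add)
  then show ?thesis
    by (simp add: linear_ext_superset[of ?A] lookup_add scale_left_distrib sum.distrib)
qed

lemma linear_ext_smult: "linear_ext sc F (hc_smult c u) = sc c (linear_ext sc F u)"
  by (simp add: linear_ext_superset[of "Poly_Mapping.keys u"] keys_hc_smult scale_sum_right)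

lemma linear_ext_cong:
  "(\<And>a. a \<in> Poly_Mapping.keys u \<Longrightarrow> F a = G a) \<Longrightarrow> linear_ext sc F u = linear_ext sc G u"
  by (simp add: linear_ext_def)

lemma linear_ext_eq_0:
  "(\<And>a. a \<in> Poly_Mapping.keys u \<Longrightarrow> F a = 0) \<Longrightarrow> linear_ext sc F u = 0"
  by (simp add: linear_ext_def)

lemma linear_ext_mem:
  assumes "subspace S" "\<And>a. a \<in> Poly_Mapping.keys u \<Longrightarrow> F a \<in> S"
  shows "linear_ext sc F u \<in> S"
  unfolding linear_ext_def using assms by (intro subspace_sum subspace_scale)

lemma linear_ext_fun_add:
  "linear_ext sc (\<lambda>a. F a + G a) u = linear_ext sc F u + linear_ext sc G u"
  by (simp add: linear_ext_def scale_right_distrib sum.distrib)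

lemma linear_ext_fun_smult: "linear_ext sc (\<lambda>a. sc c (F a)) u = sc c (linear_ext sc F u)"
  by (simp add: linear_ext_def scale_sum_right mult.commute)

lemma linear_ext_swap:
  "linear_ext sc (\<lambda>a. linear_ext sc (F a) w) u = linear_ext sc (\<lambda>b. linear_ext sc (\<lambda>a. F a b) u) w"
  unfolding linear_ext_def scale_sum_right by (subst sum.swap) (simp add: mult.commute)

lemma linear_ext_commute:
  fixes T :: "'v \<Rightarrow> 'w::ab_group_add"
  assumes add: "\<And>x y. T (x + y) = T x + T y" and smult: "\<And>c x. T (sc c x) = sc' c (T x)"
  shows "T (linear_ext sc F u) = linear_ext sc' (\<lambda>a. T (F a)) u"
proof -
  have "T 0 = 0" using add[of 0 0] by simp
  then have "T (sum f A) = (\<Sum>a\<in>A. T (f a))" for f and A :: "hc_basis set"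
    by (induction A rule: infinite_finite_induct) (simp_all add: add)
  then show ?thesis by (simp add: linear_ext_def smult)
qed

lemma superspace_UNIV:
  assumes V: "carrier V = UNIV" "\<zero>\<^bsub>V\<^esub> = 0" "add V = (+)" "module.smult V = sc"
    and sub: "\<And>i. subspace (homog V i)"
    and inter: "homog V 0 \<inter> homog V 1 = {0}"
    and sum: "\<And>v. \<exists>x\<in>homog V 0. \<exists>y\<in>homog V 1. v = x + y"
  shows "superspace V"
proof (rule superspace.intro, goal_cases)
  case 1
  show mod: "Module.module complex_ring V"
    by (rule module_complexI) (simp_all add: V algebra_simps)
  case 2
  show ?case
    by (rule superspace_axioms.intro)
      (use sub inter sum in \<open>auto simp: submodule_complex_iff[OF mod] V subspace_def set_add_def'\<close>)
qed

end

section \<open>The Heisenberg-Clifford superalgebra\<close>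

lemma subspace_homog_hc: "hc_space.subspace (homog hc i)"
  using keys_add keys_hc_smult by (fastforce simp: hc_def hc_space.subspace_def)

lemma superspace_hc: "superspace hc"
proof (rule hc_space.superspace_UNIV)
  show "homog hc 0 \<inter> homog hc 1 = {0}"
    by (auto simp: hc_def)
  fix u :: hc_elem
  let ?part = "\<lambda>i. \<Sum>a\<in>{a\<in>Poly_Mapping.keys u. hc_parity a = i}.
      Poly_Mapping.single a (Poly_Mapping.lookup u a)"
  have "?part i \<in> homog hc i" for i
    by (rule hc_space.subspace_sum) (use subspace_homog_hc in \<open>auto simp: hc_def split: if_splits\<close>)
  moreover have "u = ?part 0 + ?part 1"
  proof -
    have "u = (\<Sum>a\<in>Poly_Mapping.keys u. Poly_Mapping.single a (Poly_Mapping.lookup u a))"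
      by (rule poly_mapping_eqI) (simp add: lookup_sum lookup_single when_def in_keys_iff)
    also have "\<dots> = ?part 0 + ?part 1"
      by (subst sum.union_disjoint[symmetric]) (auto intro!: sum.cong simp: bit_not_zero_iff)
    finally show ?thesis .
  qed
  ultimately show "\<exists>x\<in>homog hc 0. \<exists>y\<in>homog hc 1. u = x + y" by blast
qed (use subspace_homog_hc in \<open>simp_all add: hc_def\<close>)

lemma hc_fields:
  "carrier hc = UNIV" "add hc = (+)" "module.smult hc = hc_smult" "zero hc = 0"
  "homog hc i = {u. \<forall>a\<in>Poly_Mapping.keys u. hc_parity a = i}"
  "bracket hc u v = linear_ext hc_smult (\<lambda>a. linear_ext hc_smult (hc_bracket_basis a) v) u"
  by (simp_all add: hc_def)

text \<open>
  \<open>[hc,hc]\<close> is contained in the line of \<open>C\<^sub>3\<close>.  This makes the Jacobi identity trivial, and it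
  reduces the compatibility of an action of central charge zero with the bracket to
  supercommutation.
\<close>

lemma keys_bracket_hc: "Poly_Mapping.keys (bracket hc u v) \<subseteq> {C3}"
proof -
  have center: "hc_space.subspace {u. Poly_Mapping.keys u \<subseteq> {C3}}"
    using keys_add keys_hc_smult by (fastforce simp: hc_space.subspace_def)
  have "Poly_Mapping.keys (hc_bracket_basis a b) \<subseteq> {C3}" for a b
    by (cases "(a, b)" rule: hc_bracket_basis.cases) auto
  then have "bracket hc u v \<in> {u. Poly_Mapping.keys u \<subseteq> {C3}}"
    unfolding hc_fields by (intro hc_space.linear_ext_mem center) auto
  then show ?thesis by simp
qed

lemma bracket_hc_center:
  assumes "Poly_Mapping.keys v \<subseteq> {C3}"
  shows "bracket hc u v = 0" "bracket hc v u = 0"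
proof -
  have "hc_bracket_basis a C3 = 0" "hc_bracket_basis C3 a = 0" for a
    by (cases a; simp)+
  then show "bracket hc u v = 0" "bracket hc v u = 0"
    unfolding hc_fields using assms by (auto intro!: hc_space.linear_ext_eq_0)
qed

lemma lie_superalgebra_hc: "lie_superalgebra hc"
proof (rule lie_superalgebra.intro[OF superspace_hc], rule lie_superalgebra_axioms.intro)
  show "bracket hc u v \<in> homog hc (i + j)" if "u \<in> homog hc i" "v \<in> homog hc j" for u v i j
  proof -
    have "hc_bracket_basis a b \<in> homog hc (hc_parity a + hc_parity b)" for a b
      by (cases "(a, b)" rule: hc_bracket_basis.cases) (auto simp: hc_fields)
    then show ?thesis
      unfolding hc_fields(6) using that
      by (intro hc_space.linear_ext_mem subspace_homog_hc) (auto simp: hc_fields(5))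
  qed
  show "bracket hc u v = (- super_sign i j) \<odot>\<^bsub>hc\<^esub> bracket hc v u"
    if "u \<in> homog hc i" "v \<in> homog hc j" for u v i j
  proof -
    \<comment> \<open>By bilinearity it is enough to compare the basis elements that occur in \<open>u\<close> and \<open>v\<close>.\<close>
    have skew: "hc_bracket_basis a b =
        hc_smult (- super_sign (hc_parity a) (hc_parity b)) (hc_bracket_basis b a)" for a b
      by (cases "(a, b)" rule: hc_bracket_basis.cases)
        (auto simp: super_sign_def poly_mapping_eq_iff fun_eq_iff lookup_single when_def
          add_eq_0_iff2 algebra_simps)
    have "bracket hc u v =
        linear_ext hc_smult (\<lambda>a. linear_ext hc_smult (\<lambda>b. hc_smult (- super_sign i j) (hc_bracket_basis b a)) v) u"
      unfolding hc_fields using that skew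
      by (intro hc_space.linear_ext_cong) (metis (mono_tags, lifting) hc_fields(5) mem_Collect_eq)
    also have "\<dots> = hc_smult (- super_sign i j) (bracket hc v u)"
      unfolding hc_fields hc_space.linear_ext_fun_smult by (subst hc_space.linear_ext_swap) (rule refl)
    finally show ?thesis by (simp add: hc_fields)
  qed
  show "bracket hc u (bracket hc v w) =
      bracket hc (bracket hc u v) w \<oplus>\<^bsub>hc\<^esub> super_sign i j \<odot>\<^bsub>hc\<^esub> bracket hc v (bracket hc u w)" for u v w i j
    by (simp add: bracket_hc_center[OF keys_bracket_hc] hc_fields(2,3))
qed (simp_all add: hc_fields hc_space.linear_ext_add hc_space.linear_ext_smult
    hc_space.linear_ext_fun_add hc_space.linear_ext_fun_smult)

section \<open>Modules of central charge zero\<close>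

text \<open>
  Brackets are multiples of \<open>C\<^sub>3\<close>, which acts by zero; so a module structure of central charge zero is
  the same thing as a supercommuting family of linear operators \<open>F a\<close>, one of the right parity for
  each basis element.
\<close>

lemma (in complex_vector_space) lie_supermodule_zero_charge:
  fixes V :: "(hc_elem, 'v, 'n) lie_supermodule_scheme"
  assumes V: "superspace V" "carrier V = UNIV" "\<zero>\<^bsub>V\<^esub> = 0" "add V = (+)" "module.smult V = sc"
    and act: "act V = (\<lambda>u v. linear_ext sc (\<lambda>a. F a v) u)"
    and F_add: "\<And>a v w. F a (v + w) = F a v + F a w"
    and F_smult: "\<And>a c v. F a (sc c v) = sc c (F a v)"
    and F_homog: "\<And>a j v. v \<in> homog V j \<Longrightarrow> F a v \<in> homog V (hc_parity a + j)"
    and F_C3: "\<And>v. F C3 v = 0"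
    and F_commute: "\<And>a b v. F a (F b v) = sc (super_sign (hc_parity a) (hc_parity b)) (F b (F a v))"
  shows "lie_supermodule hc V"
proof -
  interpret V: superspace V by fact
  have sub: "subspace (homog V i)" for i
    using V.homog_submodule[of i]
    by (simp add: submodule_complex_iff[OF V.module_axioms] subspace_def V)
  have F_ext: "F a (linear_ext sc G w) = linear_ext sc (\<lambda>b. F a (G b)) w" for a G w
    by (rule linear_ext_commute) (simp_all add: F_add F_smult)
  show ?thesis
  proof (rule lie_supermodule.intro[OF lie_superalgebra_hc V(1)], rule lie_supermodule_axioms.intro)
    show "act V u v \<in> homog V (i + j)" if "u \<in> homog hc i" "v \<in> homog V j" for u v i j
      unfolding act
    proof (intro linear_ext_mem sub)
      fix a assume "a \<in> Poly_Mapping.keys u"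
      then have "hc_parity a = i" using that by (simp add: hc_fields)
      then show "F a v \<in> homog V (i + j)" using F_homog[OF that(2)] by metis
    qed
    show "act V (bracket hc u w) v =
        act V u (act V w v) \<oplus>\<^bsub>V\<^esub> (- super_sign i j) \<odot>\<^bsub>V\<^esub> act V w (act V u v)"
      if uw: "u \<in> homog hc i" "w \<in> homog hc j" for u w v i j
    proof -
      have "F a (F b v) = sc (super_sign i j) (F b (F a v))"
        if "a \<in> Poly_Mapping.keys u" "b \<in> Poly_Mapping.keys w" for a b
        using F_commute[of a b v] uw that by (auto simp: hc_fields)
      then have "act V u (act V w v) =
          linear_ext sc (\<lambda>a. linear_ext sc (\<lambda>b. sc (super_sign i j) (F b (F a v))) w) u"
        unfolding act F_ext by (intro linear_ext_cong)
      also have "\<dots> = sc (super_sign i j) (act V w (act V u v))"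
        unfolding act F_ext linear_ext_fun_smult by (subst linear_ext_swap) (rule refl)
      finally have "act V u (act V w v) = sc (super_sign i j) (act V w (act V u v))" .
      moreover have "act V (bracket hc u w) v = 0"
        unfolding act using keys_bracket_hc[of u w] F_C3 by (intro linear_ext_eq_0) auto
      ultimately show ?thesis by (simp add: V)
    qed
  qed (simp_all add: V hc_fields act F_add F_smult linear_ext_add linear_ext_smult
      linear_ext_fun_add linear_ext_fun_smult)
qed

text \<open>
  The common shape of \<open>\<Psi>\<close> and \<open>\<Phi>\<close>: two copies of a space, one even and one odd.  The even
  generators act on both copies by the same operators \<open>A m\<close>, and the odd generators map the odd copy
  to the even copy by \<open>B k\<close>.  Two odd generators in succession give zero, so supercommutation
  amounts to commutation of the \<open>A m\<close> with one another and with the \<open>B k\<close>.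
\<close>

lemma (in complex_vector_space) lie_supermodule_doubled:
  fixes V :: "(hc_elem, 'v \<times> 'v) lie_supermodule"
  assumes V: "carrier V = UNIV" "\<zero>\<^bsub>V\<^esub> = 0" "add V = (+)" "module.smult V = psc"
      "homog V = (\<lambda>i. if i = 0 then UNIV \<times> {0} else {0} \<times> UNIV)"
      "act V = (\<lambda>u v. linear_ext psc (\<lambda>a. F a v) u)"
    and psc: "\<And>c f h. psc c (f, h) = (sc c f, sc c h)"
    and F: "\<And>m f h. F (H m) (f, h) = (A m f, A m h)" "\<And>k f h. F (Q k) (f, h) = (B k h, 0)"
      "\<And>f h. F C3 (f, h) = (0, 0)"
    and A: "\<And>m f h. A m (f + h) = A m f + A m h" "\<And>m c f. A m (sc c f) = sc c (A m f)"
    and B: "\<And>k f h. B k (f + h) = B k f + B k h" "\<And>k c f. B k (sc c f) = sc c (B k f)"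
    and commute: "\<And>m n f. A m (A n f) = A n (A m f)" "\<And>m k f. A m (B k f) = B k (A m f)"
  shows "lie_supermodule hc V"
proof -
  interpret pair: complex_vector_space psc
    by unfold_locales (auto simp: psc scale_right_distrib scale_left_distrib)
  have zero: "A m 0 = 0" "B k 0 = 0" for m k
    using A(1)[of m 0 0] B(1)[of k 0 0] by simp_all
  show ?thesis
  proof (rule pair.lie_supermodule_zero_charge[OF _ V(1-4,6)])
    show "superspace V"
      by (rule pair.superspace_UNIV[OF V(1-4)]) (auto simp: V(5) pair.subspace_def psc zero_prod_def)
  next
    show "F a v \<in> homog V (hc_parity a + j)" if "v \<in> homog V j" for a j v
      using that by (cases a; cases v; cases j) (auto simp: V(5) F zero split: if_splits)
    show "F a (v + w) = F a v + F a w" for a v w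
      by (cases a; cases v; cases w) (auto simp: F A B)
    show "F a (psc c v) = psc c (F a v)" for a c v
      by (cases a; cases v) (auto simp: F A B psc)
    show "F C3 v = 0" for v
      by (cases v) (simp add: F zero_prod_def)
    show "F a (F b v) = psc (super_sign (hc_parity a) (hc_parity b)) (F b (F a v))" for a b v
      by (cases a; cases b; cases v) (auto simp: F zero psc super_sign_def commute)
  qed
qed

section \<open>The modules \<open>\<Psi>\<close> and \<open>\<Phi>\<close>\<close>

lemma shift2_laws:
  "shift2 a (f + h) = shift2 a f + shift2 a h"
  "shift2 a (Polynomial.smult g f) = Polynomial.smult g (shift2 a f)"
  "shift2 a (shift2 b f) = shift2 b (shift2 a f)"
  by (simp_all add: shift2_def pcompose_add pcompose_smult pcompose_assoc[symmetric] pcompose_pCons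
      add.commute)

lemma shift1_laws:
  "shift1 a (f + h) = shift1 a f + shift1 a h"
  "shift1 a (Polynomial.smult c f) = Polynomial.smult c (shift1 a f)"
  "shift1 a (shift1 b f) = shift1 b (shift1 a f)"
  by (simp_all add: shift1_def pcompose_add pcompose_smult pcompose_assoc[symmetric] pcompose_pCons
      add.commute)

interpretation psi_space: complex_vector_space "\<lambda>c :: complex. Polynomial.smult [:c:] :: complex poly poly \<Rightarrow> _"
  by unfold_locales
    (simp_all add: smult_add_right mult.commute flip: smult_add_left one_pCons)

interpretation phi_space: complex_vector_space "Polynomial.smult :: complex \<Rightarrow> complex poly \<Rightarrow> complex poly"
  by unfold_locales (simp_all add: smult_add_right smult_add_left)

lemma lie_supermodule_Psi_hc: "lie_supermodule hc (Psi_hc lam)"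
  by (rule psi_space.lie_supermodule_doubled[where psc = psi_smult and F = "psi_act_basis lam"
        and A = "\<lambda>m f. Polynomial.smult [:0, lam powi m:] (shift2 (of_int m) f)"
        and B = "\<lambda>k f. Polynomial.smult [:0, lam powi (k + 1):] (shift2 (of_int k + 1 / 2) f)"])
    (simp_all add: Psi_hc_def psi_smult_def shift2_laws smult_add_right mult.commute)

lemma lie_supermodule_Phi_hc: "lie_supermodule hc (Phi_hc lam b)"
  by (rule phi_space.lie_supermodule_doubled[where psc = phi_smult and F = "phi_act_basis lam b"
        and A = "\<lambda>m f. Polynomial.smult (lam powi m * b) (shift1 (of_int m) f)"
        and B = "\<lambda>k f. Polynomial.smult (lam powi (k + 1) * b) (shift1 (of_int k + 1 / 2) f)"])
    (simp_all add: Phi_hc_def phi_smult_def shift1_laws smult_add_right mult.commute mult.left_commute)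

lemma Psi_hc_fields:
  "carrier (Psi_hc lam) = UNIV" "add (Psi_hc lam) = (+)" "\<zero>\<^bsub>Psi_hc lam\<^esub> = 0"
  "module.smult (Psi_hc lam) = psi_smult"
  "homog (Psi_hc lam) i = (if i = 0 then UNIV \<times> {0} else {0} \<times> UNIV)"
  "act (Psi_hc lam) u v = linear_ext psi_smult (\<lambda>a. psi_act_basis lam a v) u"
  by (simp_all add: Psi_hc_def)

interpretation psi_pair: complex_vector_space psi_smult
  by unfold_locales
    (auto simp: psi_smult_def smult_add_right mult.commute simp flip: smult_add_left one_pCons)

section \<open>The submodules \<open>M\<^sub>g\<close>\<close>

definition mult_pair :: "complex poly \<Rightarrow> psi_elem \<Rightarrow> psi_elem" where
  "mult_pair g = (\<lambda>(f, h). (Polynomial.smult g f, Polynomial.smult g h))"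

lemma mult_pair_hom:
  "mult_pair g (v + w) = mult_pair g v + mult_pair g w"
  "mult_pair g (psi_smult c v) = psi_smult c (mult_pair g v)"
  "mult_pair g (psi_act_basis lam a v) = psi_act_basis lam a (mult_pair g v)"
proof -
  show "mult_pair g (psi_act_basis lam a v) = psi_act_basis lam a (mult_pair g v)"
    by (cases a; cases v) (simp_all add: mult_pair_def shift2_laws mult.commute)
qed (auto simp: mult_pair_def psi_smult_def smult_add_right mult.commute split: prod.splits)

lemma act_mult_pair: "act (Psi_hc lam) u (mult_pair g v) = mult_pair g (act (Psi_hc lam) u v)"
  unfolding Psi_hc_fields
  by (subst psi_pair.linear_ext_commute[OF mult_pair_hom(1,2)]) (simp add: mult_pair_hom(3))

lemma M_hc_eq_range: "M_hc g = range (mult_pair g)"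
  by (auto simp: M_hc_def mult_pair_def image_iff)

text \<open>\<open>M\<^sub>g\<close> is the image of an endomorphism of \<open>\<Psi>\<close> that preserves the two parities.\<close>

lemma lie_submodule_M_hc: "lie_submodule hc (Psi_hc lam) (M_hc g)"
proof -
  interpret lie_supermodule hc "Psi_hc lam" by (rule lie_supermodule_Psi_hc)
  have "submodule (M_hc g) complex_ring (Psi_hc lam)"
  proof -
    have "0 = mult_pair g 0" by (simp add: mult_pair_def zero_prod_def)
    then show ?thesis
      unfolding submodule_complex_iff[OF V.module_axioms] M_hc_eq_range Psi_hc_fields
      by (auto simp: mult_pair_hom(1,2)[symmetric])
  qed
  moreover have "M_hc g = (M_hc g \<inter> homog (Psi_hc lam) 0) <+>\<^bsub>Psi_hc lam\<^esub> (M_hc g \<inter> homog (Psi_hc lam) 1)"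
  proof -
    have "0 \<in> range (Polynomial.smult g)" by (metis rangeI smult_0_right)
    then show ?thesis
      by (force simp: M_hc_def set_add_def' Psi_hc_fields)
  qed
  moreover have "act (Psi_hc lam) u v \<in> M_hc g" if "v \<in> M_hc g" for u v
    using that by (auto simp: M_hc_eq_range act_mult_pair)
  ultimately show ?thesis
    by (simp add: lie_submodule_def lie_supermodule_axioms)
qed

lemma M_hc_mult_subset: "M_hc (p * g) \<subseteq> M_hc g"
proof -
  have "Polynomial.smult (p * g) f = Polynomial.smult g (Polynomial.smult p f)" for f
    by (simp add: mult.commute)
  then show ?thesis by (auto simp only: M_hc_def)
qed

section \<open>Evaluation at \<open>y = b\<close>\<close>

definition eval_y :: "complex \<Rightarrow> complex poly poly \<Rightarrow> complex poly" where
  "eval_y b = map_poly (\<lambda>q. poly q b)"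

lemma coeff_eval_y: "coeff (eval_y b f) n = poly (coeff f n) b"
  by (simp add: eval_y_def coeff_map_poly)

lemma eval_y_add: "eval_y b (f + h) = eval_y b f + eval_y b h"
  by (simp add: poly_eq_iff coeff_eval_y)

lemma eval_y_smult: "eval_y b (Polynomial.smult g f) = Polynomial.smult (poly g b) (eval_y b f)"
  by (simp add: poly_eq_iff coeff_eval_y)

lemma eval_y_pCons: "eval_y b (pCons g f) = pCons (poly g b) (eval_y b f)"
  by (simp add: poly_eq_iff coeff_eval_y coeff_pCons split: nat.split)

lemma eval_y_shift: "eval_y b (shift2 a f) = shift1 a (eval_y b f)"
proof (induction f)
  case 0
  then show ?case by (simp add: shift2_def shift1_def eval_y_def)
next
  case (pCons g f)
  have "shift2 a (pCons g f) = [:g:] + Polynomial.smult [:a:] (shift2 a f) + pCons 0 (shift2 a f)"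
    by (simp add: shift2_def pcompose_pCons)
  then have "eval_y b (shift2 a (pCons g f)) =
      [:poly g b:] + Polynomial.smult a (shift1 a (eval_y b f)) + pCons 0 (shift1 a (eval_y b f))"
    using pCons.IH by (simp add: eval_y_add eval_y_pCons eval_y_smult) (simp add: eval_y_def)
  then show ?case by (simp add: shift1_def eval_y_pCons pcompose_pCons)
qed

lemma eval_y_const: "eval_y b (map_poly (\<lambda>c. [:c:]) q) = q"
  by (simp add: poly_eq_iff coeff_eval_y coeff_map_poly)

text \<open>
  The coefficients of \<open>f\<close> are polynomials in \<open>y\<close>; they all vanish at \<open>b\<close> iff \<open>y - b\<close> divides
  each of them, that is, iff \<open>y - b\<close> divides \<open>f\<close>.
\<close>

lemma eval_y_eq_0_iff: "eval_y b f = 0 \<longleftrightarrow> f \<in> range (Polynomial.smult [:- b, 1:])"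
proof -
  have "eval_y b f = 0 \<longleftrightarrow> [:[:- b, 1:]:] dvd f"
    by (simp add: poly_eq_iff coeff_eval_y const_poly_dvd_iff poly_eq_0_iff_dvd)
  also have "\<dots> \<longleftrightarrow> f \<in> range (Polynomial.smult [:- b, 1:])"
    by (auto simp: dvd_def)
  finally show ?thesis .
qed

definition eval_pair :: "complex \<Rightarrow> psi_elem \<Rightarrow> phi_elem" where
  "eval_pair b = (\<lambda>(f, h). (eval_y b f, eval_y b h))"

lemma eval_pair_hom:
  "eval_pair b (v + w) = eval_pair b v + eval_pair b w"
  "eval_pair b (psi_smult c v) = phi_smult c (eval_pair b v)"
  "eval_pair b (psi_act_basis lam a v) = phi_act_basis lam b a (eval_pair b v)"
proof -
  have "eval_y b 0 = 0" by (simp add: eval_y_def)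
  then show "eval_pair b (psi_act_basis lam a v) = phi_act_basis lam b a (eval_pair b v)"
    by (cases a; cases v) (simp_all add: eval_pair_def eval_y_smult eval_y_shift mult.commute)
qed (auto simp: eval_pair_def psi_smult_def phi_smult_def eval_y_smult eval_y_add split: prod.splits)

lemma Phi_hc_fields:
  "carrier (Phi_hc lam b) = UNIV" "add (Phi_hc lam b) = (+)" "\<zero>\<^bsub>Phi_hc lam b\<^esub> = 0"
  "module.smult (Phi_hc lam b) = phi_smult"
  "homog (Phi_hc lam b) i = (if i = 0 then UNIV \<times> {0} else {0} \<times> UNIV)"
  "act (Phi_hc lam b) u v = linear_ext phi_smult (\<lambda>a. phi_act_basis lam b a v) u"
  by (simp_all add: Phi_hc_def)

lemma act_eval_pair: "eval_pair b (act (Psi_hc lam) u v) = act (Phi_hc lam b) u (eval_pair b v)"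
  unfolding Psi_hc_fields Phi_hc_fields
  by (subst psi_pair.linear_ext_commute[OF eval_pair_hom(1,2)]) (simp add: eval_pair_hom(3))

lemma surj_eval_y: "surj (eval_y b)"
  using eval_y_const by (rule surjI)

text \<open>
  The surjection \<open>M\<^bsub>g'\<^esub> \<rightarrow> \<Phi>(\<lambda>,b)\<close> is division by \<open>g'\<close> followed by evaluation.  Every element of
  \<open>M\<^bsub>g'\<^esub>\<close> is \<open>g'\<close> times some \<open>w\<close>, and on it the map takes the value of \<open>w\<close> at \<open>y = b\<close>, so all its
  properties reduce to those of the evaluation.
\<close>

lemma quotient_M_hc_isomorphic:
  assumes g': "g' \<noteq> 0"
  shows "lie_supermodule_isomorphic hc
    (quotient_supermodule (restrict_supermodule (Psi_hc lam) (M_hc g')) (M_hc ([:- b, 1:] * g')))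
    (Phi_hc lam b)"
proof -
  let ?S = "restrict_supermodule (Psi_hc lam) (M_hc g')"
  have "f = h" if "Polynomial.smult g' f = Polynomial.smult g' h" for f h :: "complex poly poly"
    using that g' smult_eq_0_iff[of g' "f - h"] by (simp add: smult_diff_right)
  then have inj: "inj (mult_pair g')"
    by (auto simp: inj_def mult_pair_def)
  define \<phi> where "\<phi> v = eval_pair b (inv_into UNIV (mult_pair g') v)" for v
  have \<phi>: "\<phi> (mult_pair g' w) = eval_pair b w" for w
    by (simp add: \<phi>_def inj)
  have S: "carrier ?S = range (mult_pair g')" "add ?S = (+)" "module.smult ?S = psi_smult"
      "act ?S = act (Psi_hc lam)"
    by (simp_all add: restrict_supermodule_def Psi_hc_fields M_hc_eq_range)
  have homog_S: "homog ?S i = mult_pair g' ` homog (Psi_hc lam) i" for i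
    by (auto simp: restrict_supermodule_def Psi_hc_fields M_hc_def mult_pair_def image_iff g')
  show ?thesis
  proof (rule quotient_supermodule_isomorphic[where \<phi> = \<phi>])
    show "lie_supermodule hc ?S"
      by (rule lie_submodule_imp_supermodule_restrict[OF lie_submodule_M_hc])
    show "lie_supermodule hc (Phi_hc lam b)" by (rule lie_supermodule_Phi_hc)
    have "eval_pair b ` (X \<times> Y) = eval_y b ` X \<times> eval_y b ` Y" for X Y
      by (auto simp: eval_pair_def image_iff)
    then have eval_homog: "eval_pair b ` homog (Psi_hc lam) i = homog (Phi_hc lam b) i"
        and "range (eval_pair b) = UNIV" for i
      using surj_eval_y[of b]
      by (auto simp: Psi_hc_fields Phi_hc_fields eval_y_def simp flip: UNIV_Times_UNIV)
    then show "\<phi> ` carrier ?S = carrier (Phi_hc lam b)"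
      by (simp add: S image_image \<phi> Phi_hc_fields)
    show "\<phi> ` homog ?S i = homog (Phi_hc lam b) i" for i
      by (simp add: homog_S image_image \<phi> eval_homog)
    show "M_hc ([:- b, 1:] * g') = {v \<in> carrier ?S. \<phi> v = \<zero>\<^bsub>Phi_hc lam b\<^esub>}"
    proof -
      have "M_hc ([:- b, 1:] * g') = mult_pair g' ` M_hc [:- b, 1:]"
        unfolding M_hc_eq_range image_image by (simp add: mult_pair_def case_prod_unfold mult.commute)
      moreover have "M_hc [:- b, 1:] = {w. eval_pair b w = 0}"
        by (auto simp: M_hc_def eval_pair_def zero_prod_def eval_y_eq_0_iff)
      ultimately show ?thesis by (auto simp: S \<phi> Phi_hc_fields)
    qed
    show "\<phi> (v \<oplus>\<^bsub>?S\<^esub> w) = \<phi> v \<oplus>\<^bsub>Phi_hc lam b\<^esub> \<phi> w" if "v \<in> carrier ?S" "w \<in> carrier ?S" for v w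
      using that unfolding S Phi_hc_fields
      by (elim rangeE) (simp add: \<phi> eval_pair_hom(1) flip: mult_pair_hom(1))
    show "\<phi> (c \<odot>\<^bsub>?S\<^esub> v) = c \<odot>\<^bsub>Phi_hc lam b\<^esub> \<phi> v" if "v \<in> carrier ?S" for c v
      using that unfolding S Phi_hc_fields
      by (elim rangeE) (simp add: \<phi> eval_pair_hom(2) flip: mult_pair_hom(2))
    show "\<phi> (act ?S u v) = act (Phi_hc lam b) u (\<phi> v)" if "v \<in> carrier ?S" for u v
      using that unfolding S by (elim rangeE) (simp add: \<phi> act_mult_pair act_eval_pair)
  qed
qed

theorem proposition5p13:
  fixes lam :: complex
  assumes "lam \<noteq> 0"
  shows "(\<forall>\<alpha>::complex.
            (\<forall>n::nat. lie_submodule hc (Psi_hc lam) (M_hc ([:-\<alpha>, 1:] ^ n))) \<and>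
            (\<forall>n\<ge>1. M_hc ([:-\<alpha>, 1:] ^ n) \<subseteq> M_hc ([:-\<alpha>, 1:] ^ (n - 1))) \<and>
            M_hc ([:-\<alpha>, 1:] ^ 0) = carrier (Psi_hc lam))
       \<and> (\<forall>(b::complex) (g::complex poly) (g'::complex poly).
            g' \<noteq> 0 \<and> g = [:-b, 1:] * g' \<longrightarrow>
            lie_submodule hc (Psi_hc lam) (M_hc g') \<and>
            lie_submodule hc (restrict_supermodule (Psi_hc lam) (M_hc g')) (M_hc g) \<and>
            lie_supermodule_isomorphic hc
              (quotient_supermodule (restrict_supermodule (Psi_hc lam) (M_hc g')) (M_hc g))
              (Phi_hc lam b))"
proof (intro conjI allI impI)
  show "M_hc ([:-\<alpha>, 1:] ^ n) \<subseteq> M_hc ([:-\<alpha>, 1:] ^ (n - 1))" if "1 \<le> n" for \<alpha> n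
    using that M_hc_mult_subset[of "[:-\<alpha>, 1:]"] by (cases n) simp_all
  show "M_hc ([:-\<alpha>, 1:] ^ 0) = carrier (Psi_hc lam)" for \<alpha>
    by (simp add: M_hc_def Psi_hc_fields)
next
  fix b :: complex and g g' :: "complex poly"
  assume "g' \<noteq> 0 \<and> g = [:-b, 1:] * g'"
  then have g': "g' \<noteq> 0" and g: "g = [:-b, 1:] * g'" by blast+
  show "lie_submodule hc (restrict_supermodule (Psi_hc lam) (M_hc g')) (M_hc g)"
    unfolding g by (rule lie_submodule_restrict[OF lie_submodule_M_hc lie_submodule_M_hc M_hc_mult_subset])
  show "lie_supermodule_isomorphic hc
      (quotient_supermodule (restrict_supermodule (Psi_hc lam) (M_hc g')) (M_hc g)) (Phi_hc lam b)"
    unfolding g by (rule quotient_M_hc_isomorphic[OF g'])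
qed (rule lie_submodule_M_hc)+

end
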